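(* Let $a>0$ be a real number and $k\ge 1$ an integer. For integers $d\ge k$ and $t\ge 1$, the expected value $r(d,t)=E R(d,t)$ of the number $R(d,t)$ of nodes of degree $d$ in the random graph $H_{a,k}^{(t)}$ satisfies $$ r(d,t)=\frac{\mathrm{B}(d-k+ka,a+2)}{\mathrm{B}(ka,a+1)}\,t+O_{a,k}\left(\frac1d\right). $$ Moreover, as $d\to\infty$, the coefficient satisfies $$ \frac{\mathrm{B}(d-k+ka,a+2)}{\mathrm{B}(ka,a+1)}\sim\frac{\Gamma(a+2)}{\mathrm{B}(ka,a+1)}d^{-2-a}=(a+1)\frac{\Gamma(ka+a+1)}{\Gamma(ka)}d^{-2-a}. $$
   Context: The Buckley--Osthus random graph. Fix a real number $a>0$ and an integer $k\ge1$ (constants). Graphs are undirected, and loops and multiple edges are allowed; a loop contributes $2$ to the degree of its node. First stage: the random graph $H_{a,1}^{(t)}$ has nodes $1,\dots,t$ and $t$ edges. $H_{a,1}^{(1)}$ is the graph with one node and one loop. For $t\ge2$, $H_{a,1}^{(t)}$ is obtained from $H_{a,1}^{(t-1)}$ by adding a new node $t$ and one new edge between $t$ and a random node $\gamma\in\{1,\dots,t\}$, where, conditionally on the graph $H_{a,1}^{(t-1)}$, $$\Pr(\gamma=s)=\frac{\deg_{t-1}(s)-1+a}{(a+1)t-1}\ \text{ for } 1\le s\le t-1,\qquad \Pr(\gamma=t)=\frac{a}{(a+1)t-1},$$ and $\deg_{t-1}(s)$ is the degree of $s$ in $H_{a,1}^{(t-1)}$. Second stage: $H_{a,k}^{(t)}$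 is obtained from $H_{a,1}^{(kt)}$ by identifying the nodes $1,\dots,k$ into one node, the nodes $k+1,\dots,2k$ into a second node, and so on, which gives $t$ nodes; all $kt$ edges are kept (possibly becoming multiple edges and multiple loops). $R(d,t)$ is the number of nodes of degree $d$ in $H_{a,k}^{(t)}$. $\Gamma$ and $\mathrm{B}$ are Euler's Gamma and Beta functions, $\mathrm{B}(x,y)=\Gamma(x)\Gamma(y)/\Gamma(x+y)$. $O_{a,k}(\cdot)$ denotes a quantity bounded in absolute value by a constant depending only on $a$ and $k$ times the argument, uniformly over all $d\ge k$ and $t\ge1$. *)

theory Defs
  imports
    "HOL-Probability.Probability"
    "HOL-Library.Uprod"
    "HOL-Library.Landau_Symbols"
begin

section \<open>Undirected multigraphs with loops\<close>

text \<open>An edge is an unordered pair of nodes; \<open>Upair v v\<close> is a loop at \<open>v\<close>. Multiple edges are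
  recorded by their multiplicity in the multiset of edges.\<close>

record 'v multigraph =
  nodes :: "'v set"
  edges :: "'v uprod multiset"

definition edge_ends :: "'v uprod \<Rightarrow> 'v \<Rightarrow> nat" where
  "edge_ends e v = (if e = Upair v v then 2 else if v \<in> set_uprod e then 1 else 0)"

definition node_degree :: "'v multigraph \<Rightarrow> 'v \<Rightarrow> nat" where
  "node_degree G v = (\<Sum>e\<in>#edges G. edge_ends e v)"

definition num_nodes_of_degree :: "nat \<Rightarrow> 'v multigraph \<Rightarrow> nat" where
  "num_nodes_of_degree d G = card {v \<in> nodes G. node_degree G v = d}"

definition add_node_with_edge :: "'v \<Rightarrow> 'v \<Rightarrow> 'v multigraph \<Rightarrow> 'v multigraph" where
  "add_node_with_edge v w G =
     \<lparr>nodes = insert v (nodes G), edges = add_mset (Upair v w) (edges G)\<rparr>"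

text \<open>Identification of all nodes with the same image under \<open>f\<close>; every edge is kept.\<close>

definition identify_nodes :: "('v \<Rightarrow> 'w) \<Rightarrow> 'v multigraph \<Rightarrow> 'w multigraph" where
  "identify_nodes f G =
     \<lparr>nodes = f ` nodes G, edges = image_mset (map_uprod f) (edges G)\<rparr>"


section \<open>The Buckley--Osthus random graph\<close>

text \<open>The law of the node \<open>\<gamma>\<close> to which the new node \<open>t\<close> is joined, given that the graph on the
  nodes \<open>1, \<dots>, t - 1\<close> is \<open>G\<close>. The lemma \<open>pmf_BO_target\<close> below shows that the weights do form a
  probability mass function for every graph \<open>G\<close> that occurs, so that \<^const>\<open>embed_pmf\<close> is
  applied meaningfully.\<close>

definition BO_weight :: "real \<Rightarrow> nat \<Rightarrow> nat multigraph \<Rightarrow> nat \<Rightarrow> real" where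
  "BO_weight a t G s =
     (if 1 \<le> s \<and> s < t then (real (node_degree G s) - 1 + a) / ((a + 1) * real t - 1)
      else if s = t then a / ((a + 1) * real t - 1)
      else 0)"

definition BO_target :: "real \<Rightarrow> nat \<Rightarrow> nat multigraph \<Rightarrow> nat pmf" where
  "BO_target a t G = embed_pmf (BO_weight a t G)"

fun BO_one :: "real \<Rightarrow> nat \<Rightarrow> nat multigraph pmf" where
  "BO_one a 0 = return_pmf \<lparr>nodes = {}, edges = {#}\<rparr>"
| "BO_one a (Suc 0) = return_pmf \<lparr>nodes = {1}, edges = {#Upair 1 1#}\<rparr>"
| "BO_one a (Suc (Suc n)) =
     bind_pmf (BO_one a (Suc n)) (\<lambda>G.
       map_pmf (\<lambda>\<gamma>. add_node_with_edge (Suc (Suc n)) \<gamma> G) (BO_target a (Suc (Suc n)) G))"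

text \<open>The map \<open>i \<mapsto> (i - 1) div k + 1\<close> sends \<open>(j - 1) k + 1, \<dots>, j k\<close> to \<open>j\<close>.\<close>

definition BO_graph :: "real \<Rightarrow> nat \<Rightarrow> nat \<Rightarrow> nat multigraph pmf" where
  "BO_graph a k t = map_pmf (identify_nodes (\<lambda>i. (i - 1) div k + 1)) (BO_one a (k * t))"

definition expected_num_of_degree :: "real \<Rightarrow> nat \<Rightarrow> nat \<Rightarrow> nat \<Rightarrow> real" where
  "expected_num_of_degree a k d t =
     measure_pmf.expectation (BO_graph a k t) (\<lambda>G. real (num_nodes_of_degree d G))"


section \<open>Well-definedness\<close>

lemma edge_ends_Upair: "edge_ends (Upair x y) v = of_bool (v = x) + of_bool (v = y)"
  by (auto simp: edge_ends_def)

lemma node_degree_add: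
  "node_degree (add_node_with_edge v w G) x =
     of_bool (x = v) + of_bool (x = w) + node_degree G x"
  by (simp add: node_degree_def add_node_with_edge_def edge_ends_Upair)

definition BO_inv :: "nat \<Rightarrow> nat multigraph \<Rightarrow> bool" where
  "BO_inv n G \<longleftrightarrow> nodes G = {1..n} \<and> (\<forall>v\<in>{1..n}. node_degree G v \<ge> 1) \<and>
     (\<forall>v. v \<notin> {1..n} \<longrightarrow> node_degree G v = 0) \<and> (\<Sum>v\<in>{1..n}. node_degree G v) = 2 * n"

lemma BO_inv_pmf_BO_target:
  assumes "a > 0" "n \<ge> 1" "BO_inv n G"
  shows "pmf (BO_target a (Suc n) G) s = BO_weight a (Suc n) G s"
proof -
  let ?D = "(a + 1) * real (Suc n) - 1"
  have D: "?D > 0"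
  proof -
    have "?D = a + real n * (a + 1)" by (simp add: algebra_simps)
    thus ?thesis using assms(1) by (simp add: add_pos_nonneg)
  qed
  have nn: "BO_weight a (Suc n) G x \<ge> 0" for x
  proof (cases "1 \<le> x \<and> x \<le> n")
    case True
    hence "node_degree G x \<ge> 1" using assms(3) by (auto simp: BO_inv_def)
    hence "real (node_degree G x) - 1 + a \<ge> 0" using assms(1) by linarith
    thus ?thesis using True D by (simp add: BO_weight_def)
  qed (use assms(1) D in \<open>auto simp: BO_weight_def\<close>)
  have "(\<Sum>x\<in>{1..Suc n}. BO_weight a (Suc n) G x)
      = (\<Sum>x\<in>{1..n}. (real (node_degree G x) - 1 + a) / ?D) + a / ?D"
    by (simp add: BO_weight_def)
  also have "\<dots> = ((\<Sum>x\<in>{1..n}. real (node_degree G x)) + real n * (a - 1) + a) / ?D"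
    by (simp add: sum_divide_distrib[symmetric] sum.distrib sum_subtractf
        add_divide_distrib[symmetric] algebra_simps)
  also have "(\<Sum>x\<in>{1..n}. real (node_degree G x)) = 2 * real n"
    using assms(3) unfolding BO_inv_def of_nat_sum[symmetric] by simp
  also have "2 * real n + real n * (a - 1) + a = ?D"
    by (simp add: algebra_simps)
  finally have sum1: "(\<Sum>x\<in>{1..Suc n}. BO_weight a (Suc n) G x) = 1"
    using D by simp
  have "(\<integral>\<^sup>+x. ennreal (BO_weight a (Suc n) G x) \<partial>count_space UNIV)
      = (\<Sum>x\<in>{1..Suc n}. ennreal (BO_weight a (Suc n) G x))"
    by (rule nn_integral_count_space') (auto simp: BO_weight_def)
  also have "\<dots> = 1"
    using sum1 nn by (subst sum_ennreal) (auto simp del: sum.cl_ivl_Suc)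
  finally show ?thesis
    unfolding BO_target_def using nn by (intro pmf_embed_pmf) auto
qed

lemma set_pmf_BO_target:
  assumes "a > 0" "n \<ge> 1" "BO_inv n G"
  shows "set_pmf (BO_target a (Suc n) G) \<subseteq> {1..Suc n}"
  using BO_inv_pmf_BO_target[OF assms]
  by (auto simp: set_pmf_eq BO_weight_def split: if_splits)

lemma BO_inv_step:
  assumes "BO_inv n G" "w \<in> {1..Suc n}"
  shows "BO_inv (Suc n) (add_node_with_edge (Suc n) w G)"
proof -
  let ?H = "add_node_with_edge (Suc n) w G"
  have "(\<Sum>v\<in>{1..Suc n}. node_degree ?H v) =
      (\<Sum>v\<in>{1..Suc n}. of_bool (v = Suc n)) + (\<Sum>v\<in>{1..Suc n}. of_bool (v = w))
      + (\<Sum>v\<in>{1..Suc n}. node_degree G v)"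
    by (simp only: node_degree_add sum.distrib)
  also have "(\<Sum>v\<in>{1..Suc n}. of_bool (v = Suc n)) = (1::nat)"
    by (simp only: of_bool_def sum.delta) simp
  also have "(\<Sum>v\<in>{1..Suc n}. of_bool (v = w)) = (1::nat)"
    using assms(2) by (simp only: of_bool_def sum.delta) simp
  also have "(\<Sum>v\<in>{1..Suc n}. node_degree G v) = 2 * n"
    using assms(1) by (simp add: BO_inv_def)
  finally have "(\<Sum>v\<in>{1..Suc n}. node_degree ?H v) = 2 * Suc n" by simp
  moreover have "nodes ?H = {1..Suc n}"
    using assms(1) by (auto simp: BO_inv_def add_node_with_edge_def)
  moreover have "node_degree ?H v \<ge> 1" if "v \<in> {1..Suc n}" for v
  proof (cases "v = Suc n")
    case False
    hence "v \<in> {1..n}" using that by auto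
    hence "node_degree G v \<ge> 1" using assms(1) by (auto simp: BO_inv_def)
    thus ?thesis by (simp add: node_degree_add)
  qed (simp add: node_degree_add)
  moreover have "node_degree ?H v = 0" if "v \<notin> {1..Suc n}" for v
  proof -
    have "v \<notin> {1..n}" "v \<noteq> w" "v \<noteq> Suc n" using that assms(2) by auto
    thus ?thesis using assms(1) by (simp add: BO_inv_def node_degree_add)
  qed
  ultimately show ?thesis unfolding BO_inv_def by blast
qed

lemma BO_inv_BO_one:
  assumes "a > 0" "n \<ge> 1" "G \<in> set_pmf (BO_one a n)"
  shows "BO_inv n G"
  using assms
proof (induction a n arbitrary: G rule: BO_one.induct)
  case (2 a)
  thus ?case by (auto simp: BO_inv_def node_degree_def edge_ends_Upair)
next
  case (3 a n)
  then obtain G' \<gamma> where G': "G' \<in> set_pmf (BO_one a (Suc n))"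
      and \<gamma>: "\<gamma> \<in> set_pmf (BO_target a (Suc (Suc n)) G')"
      and G: "G = add_node_with_edge (Suc (Suc n)) \<gamma> G'"
    by auto
  have inv: "BO_inv (Suc n) G'" using "3.IH" "3.prems"(1) G' by auto
  have "\<gamma> \<in> {1..Suc (Suc n)}"
    using set_pmf_BO_target[OF "3.prems"(1) _ inv] \<gamma> by auto
  thus ?case using BO_inv_step[OF inv] G by simp
qed simp

lemma pmf_BO_target:
  assumes "a > 0" "t \<ge> 2" "G \<in> set_pmf (BO_one a (t - 1))"
  shows "pmf (BO_target a t G) s = BO_weight a t G s"
proof -
  have "BO_inv (t - 1) G" using BO_inv_BO_one[of a "t - 1" G] assms by auto
  thus ?thesis using BO_inv_pmf_BO_target[of a "t - 1" G s] assms by simp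
qed

lemma finite_set_pmf_BO_one:
  assumes "a > 0"
  shows "finite (set_pmf (BO_one a n))"
  using assms
proof (induction a n rule: BO_one.induct)
  case (3 a n)
  have "finite (set_pmf (BO_target a (Suc (Suc n)) G))"
    if "G \<in> set_pmf (BO_one a (Suc n))" for G
    using set_pmf_BO_target[OF "3.prems" _ BO_inv_BO_one[OF "3.prems" _ that]]
    by (auto intro: finite_subset)
  thus ?case using 3 by simp
qed simp_all

lemma finite_set_pmf_BO_graph: "a > 0 \<Longrightarrow> finite (set_pmf (BO_graph a k t))"
  by (simp add: BO_graph_def finite_set_pmf_BO_one)

lemma nodes_BO_graph:
  assumes "a > 0" "k \<ge> 1" "t \<ge> 1" "G \<in> set_pmf (BO_graph a k t)"
  shows "nodes G = {1..t}"
proof -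
  let ?f = "\<lambda>i. (i - 1) div k + 1"
  obtain G' where G': "G' \<in> set_pmf (BO_one a (k * t))" "G = identify_nodes ?f G'"
    using assms(4) by (auto simp: BO_graph_def)
  have "nodes G' = {1..k * t}"
    using BO_inv_BO_one[OF assms(1) _ G'(1)] assms(2,3) by (simp add: BO_inv_def)
  hence "nodes G = ?f ` {1..k * t}" using G'(2) by (simp add: identify_nodes_def)
  also have "\<dots> = {1..t}"
  proof (intro equalityI subsetI)
    fix j assume "j \<in> ?f ` {1..k * t}"
    then obtain i where i: "i \<in> {1..k * t}" "j = ?f i" by blast
    hence "i - 1 < t * k" by (auto simp: mult.commute)
    hence "(i - 1) div k < t" by (rule less_mult_imp_div_less)
    thus "j \<in> {1..t}" using i by simp
  next
    fix j assume j: "j \<in> {1..t}"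
    hence mem: "k * j \<in> {1..k * t}" using assms(2) by auto
    have eq: "?f (k * j) = j"
    proof -
      obtain i where i: "j = Suc i" using j by (cases j) auto
      have "k * j - 1 = (k - 1) + k * i" using assms(2) unfolding i mult_Suc_right by linarith
      also have "\<dots> div k = i + (k - 1) div k" using assms(2) by (intro div_mult_self2) linarith
      also have "(k - 1) div k = 0" using assms(2) by (intro div_less) linarith
      finally show ?thesis unfolding i by linarith
    qed
    show "j \<in> ?f ` {1..k * t}" using mem by (rule rev_image_eqI) (rule eq[symmetric])
  qed
  finally show ?thesis .
qed

end

theory Submission
  imports Defs "HOL-Real_Asymp.Real_Asymp"
begin

text \<open>Split the nodes of the first-stage graph into the blocks that get identified, and let \<open>c\<close> be the
  degree of a block minus its number of nodes. When the graph grows from \<open>n\<close> to \<open>n + 1\<close> nodes, \<open>c\<close>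
  increases by one with probability \<open>(c + m a) / D\<close>, where \<open>m\<close> is the number of nodes of the block
  and \<open>D = (a + 1) n + a\<close>. Hence the expected number of blocks with excess \<open>c\<close> satisfies a linear
  recursion, which \<open>b c * D / ((a + 1) k)\<close> solves, \<open>b\<close> being the quotient of Beta functions, up to errors
  of order \<open>1 / n\<close> at \<open>c \<le> k\<close> caused by the one incomplete block. Since \<open>1 / (c + k a)\<close> loses only
  mass \<open>1 / D\<close> at \<open>c = 0\<close> in each step, a multiple of it dominates the accumulated errors.\<close>

section \<open>Asymptotics of the Beta function\<close>

lemma Beta_pos: "x > 0 \<Longrightarrow> y > 0 \<Longrightarrow> Beta x y > (0 :: real)"
  by (simp add: Beta_def Gamma_real_pos)

text \<open>Both \<open>Gamma (x + n)\<close> and \<open>Gamma (x + y + n)\<close> are Pochhammer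
  multiples of fixed Gamma values. In the quotient of the two Gamma series the factorials cancel,
  leaving \<open>n powr y\<close> times the quotient of Pochhammer symbols.\<close>

lemma Beta_asymp_equiv:
  fixes x y :: real
  assumes "x > 0" "y > 0"
  shows "(\<lambda>n. Beta (real n + x) y) \<sim>[at_top] (\<lambda>n. Gamma y * real n powr (- y))"
proof (rule asymp_equivI')
  have pos: "Gamma x > 0" "Gamma y > 0" "Gamma (x + y) > 0"
    using assms by (simp_all add: Gamma_real_pos)
  have not_nonpos: "x \<notin> \<int>\<^sub>\<le>\<^sub>0" "x + y \<notin> \<int>\<^sub>\<le>\<^sub>0"
    using assms by (auto dest!: nonpos_Ints_nonpos)
  have "(\<lambda>n. Gamma_series' (x + y) n / Gamma_series' x n * (Gamma x / Gamma (x + y)))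
      \<longlonglongrightarrow> Gamma (x + y) / Gamma x * (Gamma x / Gamma (x + y))"
    using pos by (intro tendsto_intros Gamma_series'_LIMSEQ) auto
  moreover have "eventually (\<lambda>n. Gamma_series' (x + y) n / Gamma_series' x n * (Gamma x / Gamma (x + y))
      = Beta (real n + x) y / (Gamma y * real n powr (- y))) sequentially"
    using eventually_gt_at_top[of 0]
  proof eventually_elim
    case (elim n)
    have P: "pochhammer x n > 0" "pochhammer (x + y) n > 0"
      using assms by (auto intro: pochhammer_pos)
    have G: "Gamma (x + real n) = pochhammer x n * Gamma x"
        "Gamma (x + y + real n) = pochhammer (x + y) n * Gamma (x + y)"
      using pos by (simp_all add: pochhammer_Gamma not_nonpos)
    have "Beta (real n + x) y = Gamma (x + real n) * Gamma y / Gamma (x + y + real n)"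
      by (simp add: Beta_def add_ac)
    hence "Beta (real n + x) y / (Gamma y * real n powr (- y))
        = pochhammer x n * Gamma x / (pochhammer (x + y) n * Gamma (x + y)) * real n powr y"
      unfolding G using pos elim by (simp add: powr_minus field_simps)
    moreover have "Gamma_series' (x + y) n / Gamma_series' x n
        = pochhammer x n / pochhammer (x + y) n * real n powr y"
      using elim P by (simp add: Gamma_series'_def powr_def exp_add field_simps)
    ultimately show ?case by (simp add: field_simps)
  qed
  ultimately show "(\<lambda>n. Beta (real n + x) y / (Gamma y * real n powr (- y))) \<longlonglongrightarrow> 1"
    using pos by (auto dest: Lim_transform_eventually)
qed


section \<open>Perturbed birth recursions\<close>

text \<open>Forward equation of a pure birth chain that jumps from \<open>c\<close> to
  \<open>c + 1\<close> with probability \<open>(c + r) / D\<close>; \<open>f\<close> is a possibly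
  signed mass on the states.\<close>

definition birth_step :: "real \<Rightarrow> real \<Rightarrow> (nat \<Rightarrow> real) \<Rightarrow> nat \<Rightarrow> real" where
  "birth_step r D f c = f c * (1 - (real c + r) / D) +
     (if c = 0 then 0 else f (c - 1) * ((real (c - 1) + r) / D))"

text \<open>Because \<open>c + r <= D\<close> and \<open>r >= 0\<close>, both weights of the step at
  \<open>c\<close> are nonnegative, so absolute values can be taken inside.\<close>

lemma abs_birth_step_le:
  assumes "\<And>i. i \<le> c \<Longrightarrow> \<bar>f i\<bar> \<le> g i" "0 \<le> r" "real c + r \<le> D" "D > 0"
  shows "\<bar>birth_step r D f c\<bar> \<le> birth_step r D g c"
proof -
  have "\<bar>f c * (1 - (real c + r) / D)\<bar> \<le> g c * (1 - (real c + r) / D)"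
    using assms(1)[of c] assms(3,4) by (simp add: abs_mult mult_right_mono)
  moreover have "\<bar>f (c - 1) * ((real (c - 1) + r) / D)\<bar> \<le> g (c - 1) * ((real (c - 1) + r) / D)"
    using assms(1)[of "c - 1"] assms(2,4) by (simp only: abs_mult) (simp add: divide_right_mono mult_right_mono)
  ultimately show ?thesis by (auto simp: birth_step_def intro: order_trans[OF abs_triangle_ineq add_mono])
qed

text \<open>The sequence \<open>1 / (c + r)\<close> is stationary for the birth step up to a loss of \<open>1 / D\<close> at \<open>0\<close>;
  adding its truncations to \<open>c \<ge> 1, \<dots>, c \<ge> k\<close> produces a loss of \<open>1 / D\<close> at each \<open>c \<le> k\<close>,
  which absorbs perturbations of order \<open>1 / D\<close> supported there.\<close>

definition barrier :: "nat \<Rightarrow> real \<Rightarrow> nat \<Rightarrow> real" where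
  "barrier k r c = (real (min c k) + 1) / (real c + r)"

lemma barrier_bounds:
  assumes "r > 0"
  shows "1 / (real c + r) \<le> barrier k r c" "barrier k r c \<le> (real k + 1) / (real c + r)"
  using assms by (auto simp: barrier_def intro!: divide_right_mono)

text \<open>The flux out of state \<open>i\<close> is \<open>K * (min i k + 1) / D\<close>. From
  each state up to \<open>k\<close> to the next it grows by \<open>K / D\<close>, and beyond
  \<open>k\<close> it is constant, so there inflow and outflow balance.\<close>

lemma birth_step_barrier:
  assumes "r > 0" "D > 0"
  shows "birth_step r D (\<lambda>c. K * barrier k r c) c = K * barrier k r c - (if c \<le> k then K / D else 0)"
proof (cases c)
  case 0
  thus ?thesis using assms by (simp add: birth_step_def barrier_def field_simps)
next
  case (Suc c')
  have *: "K * barrier k r i * ((real i + r) / D) = K * (real (min i k) + 1) / D" for i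
    using assms by (simp add: barrier_def)
  have "birth_step r D (\<lambda>c. K * barrier k r c) c
      = K * barrier k r c - K * barrier k r c * ((real c + r) / D)
        + K * barrier k r c' * ((real c' + r) / D)"
    using Suc by (simp add: birth_step_def right_diff_distrib)
  also have "\<dots> = K * barrier k r c - K * (real (min c k) + 1) / D + K * (real (min c' k) + 1) / D"
    unfolding * ..
  also have "\<dots> = K * barrier k r c - (if c \<le> k then K / D else 0)"
    using Suc by (auto simp: min_def diff_divide_distrib[symmetric] algebra_simps add_divide_distrib)
  finally show ?thesis .
qed

text \<open>Comparison principle: by induction on \<open>n\<close>, a multiple of the barrier
  dominates \<open>e n\<close>. Monotonicity of the step is used only for large \<open>n\<close> and
  \<open>c <= n + 1\<close>; \<open>far\<close> and \<open>crude\<close> cover the rest.\<close>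

lemma perturbed_birth_bound:
  fixes e :: "nat \<Rightarrow> nat \<Rightarrow> real" and a r L B :: real
  defines "D \<equiv> \<lambda>n::nat. (a + 1) * real n + a"
  assumes "a > 0" "r > 0"
    and rec: "\<And>n c. n \<ge> 1 \<Longrightarrow>
      \<bar>e (Suc n) c - birth_step r (D n) (e n) c\<bar> \<le> (if c \<le> k then L / D n else 0)"
    and far: "\<And>n c. n \<ge> 1 \<Longrightarrow> c > n \<Longrightarrow> \<bar>e n c\<bar> \<le> B / (real c + r)"
    and crude: "\<And>n c. n \<ge> 1 \<Longrightarrow> \<bar>e n c\<bar> \<le> B * (real n + 1)"
  shows "\<exists>K. \<forall>n\<ge>1. \<forall>c. \<bar>e n c\<bar> \<le> K / (real c + r)"
proof -
  \<comment> \<open>For \<open>n >= N\<close> this gives \<open>1 + r < a * n\<close>, hence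
    \<open>c + r <= D n\<close> for all \<open>c <= n + 1\<close>.\<close>
  obtain N :: nat where N: "real N > (1 + r) / a" using reals_Archimedean2 by blast
  have Dpos: "D n > 0" for n using \<open>a > 0\<close> by (simp add: D_def add_nonneg_pos)
  have "0 \<le> \<bar>e 1 0\<bar>" by simp
  also have "\<dots> \<le> B * (real 1 + 1)" by (rule crude) simp
  finally have "B \<ge> 0" by simp
  \<comment> \<open>\<open>B\<close> serves \<open>c > n\<close>, \<open>L\<close> the error added
    in each step, and the last term the finitely many pairs \<open>c <= n <= N\<close>.\<close>
  define K where "K = max B (max L (B * (real N + 1) * (real N + r)))"
  have K: "K \<ge> B" "K \<ge> L" "K \<ge> B * (real N + 1) * (real N + r)"
    by (simp_all add: K_def)
  have weaken: "\<bar>e n c\<bar> \<le> K * barrier k r c" if "\<bar>e n c\<bar> \<le> K / (real c + r)" for n c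
  proof -
    have "K * (1 / (real c + r)) \<le> K * barrier k r c"
      using K(1) \<open>B \<ge> 0\<close> barrier_bounds(1)[OF \<open>r > 0\<close>] by (intro mult_left_mono) auto
    thus ?thesis using that by simp
  qed
  have far': "\<bar>e n c\<bar> \<le> K * barrier k r c" if "n \<ge> 1" "c > n" for n c
  proof (rule weaken)
    show "\<bar>e n c\<bar> \<le> K / (real c + r)"
      using far[OF that] K(1) \<open>r > 0\<close> by (elim order_trans) (simp add: divide_right_mono)
  qed
  have "\<bar>e n c\<bar> \<le> K * barrier k r c" if "n \<ge> 1" for n c
    using that
  proof (induction n arbitrary: c)
    case (Suc n)
    consider "c > Suc n" | "c \<le> Suc n" "Suc n \<le> N" | "c \<le> Suc n" "n \<ge> N" by linarith
    thus ?case
    proof cases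
      case 1
      thus ?thesis by (intro far') auto
    next
      case 2
      have "\<bar>e (Suc n) c\<bar> * (real c + r) \<le> B * (real N + 1) * (real N + r)"
      proof (intro mult_mono)
        show "\<bar>e (Suc n) c\<bar> \<le> B * (real N + 1)"
          using 2 \<open>B \<ge> 0\<close> by (intro order_trans[OF crude] mult_left_mono) auto
      qed (use 2 \<open>B \<ge> 0\<close> \<open>r > 0\<close> in auto)
      also have "\<dots> \<le> K" by (rule K)
      finally show ?thesis using \<open>r > 0\<close> by (intro weaken) (simp add: field_simps)
    next
      case 3
      have "(1 + r) / a < real n" using N 3 by simp
      hence "1 + r < a * real n" using \<open>a > 0\<close> by (simp add: field_simps)
      moreover have "0 < 1 + r" using \<open>r > 0\<close> by simp
      ultimately have n: "n \<ge> 1" using \<open>a > 0\<close> by (cases n) auto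
      have "real c \<le> real n + 1" using 3 by linarith
      hence cD: "real c + r \<le> D n"
        using \<open>1 + r < a * real n\<close> \<open>a > 0\<close> by (simp add: D_def algebra_simps)
      have "\<bar>birth_step r (D n) (e n) c\<bar> \<le> birth_step r (D n) (\<lambda>c. K * barrier k r c) c"
        using Suc.IH[OF n] cD Dpos \<open>r > 0\<close> by (intro abs_birth_step_le) auto
      also have "\<dots> = K * barrier k r c - (if c \<le> k then K / D n else 0)"
        by (rule birth_step_barrier) (use Dpos \<open>r > 0\<close> in auto)
      finally have "\<bar>birth_step r (D n) (e n) c\<bar> \<le> K * barrier k r c - (if c \<le> k then K / D n else 0)" .
      \<comment> \<open>The loss \<open>K / D n\<close> of the barrier pays for the
        perturbation.\<close>
      moreover have "L / D n \<le> K / D n"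
        using K(2) Dpos[of n] by (intro divide_right_mono) auto
      ultimately show ?thesis using rec[OF n, of c] by (auto split: if_splits)
    qed
  qed simp
  moreover have "K * barrier k r c \<le> K * (real k + 1) / (real c + r)" for c
    using K(1) \<open>B \<ge> 0\<close> mult_left_mono[OF barrier_bounds(2)[OF \<open>r > 0\<close>, of k c], of K] by auto
  ultimately have "\<bar>e n c\<bar> \<le> K * (real k + 1) / (real c + r)" if "n \<ge> 1" for n c
    using that by (blast intro: order_trans)
  thus ?thesis by blast
qed


section \<open>Blocks of nodes\<close>

lemma sum_of_bool_eq_filter:
  assumes "finite V"
  shows "(\<Sum>v\<in>{v\<in>V. P v}. of_bool (v = x)) = (of_bool (x \<in> V \<and> P x) :: nat)"
  using assms by (simp add: of_bool_def)

text \<open>The ends of an edge at \<open>w\<close> are its ends in the fibre of \<open>w\<close>,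
  also when the edge turns into a loop; induction on the multiset of edges adds them up.\<close>

lemma node_degree_identify_nodes:
  assumes "finite V" "\<And>v. v \<notin> V \<Longrightarrow> node_degree G v = 0"
  shows "node_degree (identify_nodes f G) w = (\<Sum>v | v \<in> V \<and> f v = w. node_degree G v)"
proof -
  \<comment> \<open>An edge meeting a node outside \<open>V\<close> would give that node positive
    degree. Hence the part of the fibre inside \<open>V\<close> carries all ends.\<close>
  have "set_uprod x \<subseteq> V" if "x \<in># edges G" for x
  proof
    fix v assume v: "v \<in> set_uprod x"
    have "edge_ends x v \<le> node_degree G v"
      unfolding node_degree_def using that by (auto dest!: multi_member_split)
    moreover have "edge_ends x v \<noteq> 0" using v by (simp add: edge_ends_def)
    ultimately show "v \<in> V" using assms(2) by (metis le_zero_eq)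
  qed
  moreover have "(\<Sum>e\<in>#image_mset (map_uprod f) M. edge_ends e w)
      = (\<Sum>v | v \<in> V \<and> f v = w. \<Sum>e\<in>#M. edge_ends e v)"
    if "\<And>x. x \<in># M \<Longrightarrow> set_uprod x \<subseteq> V" for M
    using that
  proof (induction M)
    case (add x M)
    obtain y z where x: "x = Upair y z" by (cases x)
    have "y \<in> V" "z \<in> V" using add.prems[of x] x by auto
    thus ?case using add assms(1)
      by (simp add: x edge_ends_Upair sum.distrib sum_of_bool_eq_filter eq_commute[of w])
  qed simp
  ultimately show ?thesis unfolding node_degree_def identify_nodes_def by simp
qed

section \<open>One-step law of the excess of a block\<close>

definition block :: "nat \<Rightarrow> nat \<Rightarrow> nat set" where
  "block k q = {q * k + 1..q * k + k}"

lemma finite_block [simp]: "finite (block k q)"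
  by (simp add: block_def)

text \<open>The subtraction is truncated, so that nodes not yet present (degree \<open>0\<close>) contribute \<open>0\<close>.\<close>

definition excess :: "nat \<Rightarrow> nat \<Rightarrow> nat multigraph \<Rightarrow> nat" where
  "excess k q G = (\<Sum>v\<in>block k q. node_degree G v - 1)"

definition excess_pmf :: "real \<Rightarrow> nat \<Rightarrow> nat \<Rightarrow> nat \<Rightarrow> nat pmf" where
  "excess_pmf a k q n = map_pmf (excess k q) (BO_one a n)"

text \<open>The end of the new edge at \<open>Suc n\<close> itself is offset by the
  \<open>- 1\<close> in the excess, so only the end at \<open>w\<close> counts, also for the loop
  \<open>w = Suc n\<close>.\<close>

lemma excess_add_node:
  assumes "BO_inv n G" "w \<in> {1..Suc n}"
  shows "excess k q (add_node_with_edge (Suc n) w G) = excess k q G + of_bool (w \<in> block k q)"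
proof -
  have "node_degree (add_node_with_edge (Suc n) w G) v - 1
      = (node_degree G v - 1) + of_bool (v = w)" if "v \<in> block k q" for v
  proof (cases "v \<le> n")
    case True
    hence "node_degree G v \<ge> 1" using assms(1) that by (simp add: BO_inv_def block_def)
    thus ?thesis using True by (simp add: node_degree_add)
  next
    case False
    hence "node_degree G v = 0" using assms(1) by (simp add: BO_inv_def)
    thus ?thesis using False assms(2) by (auto simp: node_degree_add)
  qed
  thus ?thesis by (simp add: excess_def sum.distrib of_bool_def)
qed

text \<open>Every node present at time \<open>n + 1\<close>, the new one included, has weight
  \<open>a\<close> plus its contribution to the excess. So the graph enters only through the excess,
  and the law of the excess obeys a closed recursion.\<close>

lemma prob_BO_target_block:
  assumes "a > 0" "n \<ge> 1" "BO_inv n G"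
  shows "measure_pmf.prob (BO_target a (Suc n) G) (block k q)
    = (real (excess k q G) + a * card (block k q \<inter> {..Suc n})) / ((a + 1) * real n + a)"
proof -
  have D: "(a + 1) * real (Suc n) - 1 = (a + 1) * real n + a" by (simp add: algebra_simps)
  have "BO_weight a (Suc n) G v
      = (real (node_degree G v - 1) + a * of_bool (v \<in> {..Suc n})) / ((a + 1) * real n + a)"
    if "v \<in> block k q" for v
  proof -
    have "v \<ge> 1" using that by (simp add: block_def)
    consider "v \<le> n" | "v = Suc n" | "v > Suc n" by linarith
    thus ?thesis
    proof cases
      case 1
      hence "node_degree G v \<ge> 1" using assms(3) \<open>v \<ge> 1\<close> by (simp add: BO_inv_def)
      thus ?thesis using 1 \<open>v \<ge> 1\<close> unfolding BO_weight_def D by (simp add: of_nat_diff)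
    next
      case 2
      hence "node_degree G v = 0" using assms(3) by (simp add: BO_inv_def)
      thus ?thesis using 2 unfolding BO_weight_def D by simp
    qed (use assms(3) in \<open>auto simp: BO_inv_def BO_weight_def\<close>)
  qed
  hence "measure_pmf.prob (BO_target a (Suc n) G) (block k q)
      = (\<Sum>v\<in>block k q. (real (node_degree G v - 1) + a * of_bool (v \<in> {..Suc n})) / ((a + 1) * real n + a))"
    by (simp add: measure_measure_pmf_finite BO_inv_pmf_BO_target[OF assms])
  also have "\<dots> = ((\<Sum>v\<in>block k q. real (node_degree G v - 1))
      + a * (\<Sum>v\<in>block k q. of_bool (v \<in> {..Suc n}))) / ((a + 1) * real n + a)"
    by (simp only: sum_divide_distrib[symmetric] sum.distrib sum_distrib_left)
  also have "(\<Sum>v\<in>block k q. of_bool (v \<in> {..Suc n})) = real (card (block k q \<inter> {..Suc n}))"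
    by (simp only: sum_of_bool_eq finite_block Collect_mem_eq)
  finally show ?thesis by (simp add: excess_def)
qed

lemma pmf_map_add_of_bool:
  "pmf (map_pmf (\<lambda>x. e + of_bool (x \<in> B)) M) (c::nat) =
     of_bool (e = c) * (1 - measure_pmf.prob M B) +
     of_bool (c \<noteq> 0 \<and> e = c - 1) * measure_pmf.prob M B"
proof -
  have "(\<lambda>x. e + of_bool (x \<in> B)) -` {c} =
      (if e = c then - B else if c \<noteq> 0 \<and> e = c - 1 then B else {})"
    by (auto simp: of_bool_def split: if_splits)
  moreover have "measure_pmf.prob M (- B) = 1 - measure_pmf.prob M B"
    using measure_pmf.prob_compl[of B M] by (simp add: Compl_eq_Diff_UNIV)
  ultimately show ?thesis by (auto simp: pmf_map)
qed

lemma pmf_excess_pmf: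
  "pmf (excess_pmf a k q n) c = measure_pmf.expectation (BO_one a n) (\<lambda>G. of_bool (excess k q G = c))"
proof -
  have "(\<lambda>G. of_bool (excess k q G = c)) = (indicator (excess k q -` {c}) :: _ \<Rightarrow> real)"
    by (auto simp: indicator_def)
  thus ?thesis by (simp add: excess_pmf_def pmf_map)
qed

lemma pmf_excess_pmf_Suc:
  fixes a :: real and k q :: nat
  assumes "a > 0" "n \<ge> 1"
  defines "p \<equiv> \<lambda>x. (real x + a * card (block k q \<inter> {..Suc n})) / ((a + 1) * real n + a)"
  shows "pmf (excess_pmf a k q (Suc n)) c = pmf (excess_pmf a k q n) c * (1 - p c) +
    (if c = 0 then 0 else pmf (excess_pmf a k q n) (c - 1) * p (c - 1))"
proof -
  have "BO_one a (Suc n) = bind_pmf (BO_one a n) (\<lambda>G.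
       map_pmf (\<lambda>\<gamma>. add_node_with_edge (Suc n) \<gamma> G) (BO_target a (Suc n) G))"
    using assms(2) by (cases n) auto
  hence "pmf (excess_pmf a k q (Suc n)) c = measure_pmf.expectation (BO_one a n)
      (\<lambda>G. pmf (map_pmf (\<lambda>\<gamma>. excess k q (add_node_with_edge (Suc n) \<gamma> G)) (BO_target a (Suc n) G)) c)"
    by (simp add: excess_pmf_def map_bind_pmf pmf_bind map_pmf_comp)
  also have "\<dots> = measure_pmf.expectation (BO_one a n)
      (\<lambda>G. of_bool (excess k q G = c) * (1 - p c) + of_bool (c \<noteq> 0 \<and> excess k q G = c - 1) * p (c - 1))"
  \<comment> \<open>The integrands are compared on the support only, where \<open>BO_inv\<close>
    holds.\<close>
  proof (intro integral_cong_AE)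
    have "pmf (map_pmf (\<lambda>\<gamma>. excess k q (add_node_with_edge (Suc n) \<gamma> G)) (BO_target a (Suc n) G)) c
      = of_bool (excess k q G = c) * (1 - p c) + of_bool (c \<noteq> 0 \<and> excess k q G = c - 1) * p (c - 1)"
      if "G \<in> set_pmf (BO_one a n)" for G
    proof -
      have inv: "BO_inv n G" using BO_inv_BO_one[OF assms(1,2) that] .
      have "map_pmf (\<lambda>\<gamma>. excess k q (add_node_with_edge (Suc n) \<gamma> G)) (BO_target a (Suc n) G)
          = map_pmf (\<lambda>\<gamma>. excess k q G + of_bool (\<gamma> \<in> block k q)) (BO_target a (Suc n) G)"
        using set_pmf_BO_target[OF assms(1,2) inv]
        by (intro map_pmf_cong refl excess_add_node[OF inv]) auto
      thus ?thesis
        by (simp add: pmf_map_add_of_bool prob_BO_target_block[OF assms(1,2) inv] p_def)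
    qed
    thus "AE G in measure_pmf (BO_one a n).
      pmf (map_pmf (\<lambda>\<gamma>. excess k q (add_node_with_edge (Suc n) \<gamma> G)) (BO_target a (Suc n) G)) c
      = of_bool (excess k q G = c) * (1 - p c) + of_bool (c \<noteq> 0 \<and> excess k q G = c - 1) * p (c - 1)"
      by (simp add: AE_measure_pmf_iff)
  qed auto
  also have "\<dots> = pmf (excess_pmf a k q n) c * (1 - p c) +
    (if c = 0 then 0 else pmf (excess_pmf a k q n) (c - 1) * p (c - 1))"
    using finite_set_pmf_BO_one[OF assms(1)]
    by (cases "c = 0") (simp_all add: pmf_excess_pmf integrable_measure_pmf_finite)
  finally show ?thesis .
qed

lemma card_block_Int: "card (block k q \<inter> {..Suc n}) = min (q * k + k) (Suc n) - q * k"
proof -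
  have "block k q \<inter> {..Suc n} = {q * k + 1..min (q * k + k) (Suc n)}" by (auto simp: block_def)
  thus ?thesis by simp
qed

text \<open>No edge reaches the block before its first node \<open>q * k + 1\<close> exists, and
  from then on each new edge adds at most 1 to the excess.\<close>

lemma pmf_excess_pmf_eq_0:
  assumes "a > 0" "k \<ge> 1" "n \<ge> 1" "c > n - q * k"
  shows "pmf (excess_pmf a k q n) c = 0"
  using assms(3,4)
proof (induction n arbitrary: c rule: dec_induct)
  case base
  have "node_degree \<lparr>nodes = {1}, edges = {#Upair 1 1#}\<rparr> v - 1 = of_bool (v = 1)" for v :: nat
    by (simp add: node_degree_def edge_ends_Upair)
  hence "excess k q \<lparr>nodes = {1}, edges = {#Upair 1 1#}\<rparr> = of_bool (1 \<in> block k q)"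
    unfolding excess_def by (simp add: of_bool_def)
  hence "excess k q \<lparr>nodes = {1}, edges = {#Upair 1 1#}\<rparr> \<le> 1 - q * k"
    by (auto simp: block_def)
  thus ?case using base by (auto simp: excess_pmf_def pmf_return)
next
  case (step n)
  have 0: "pmf (excess_pmf a k q n) c = 0" using step by auto
  have "pmf (excess_pmf a k q n) (c - 1) = 0 \<or> real (c - 1) + a * card (block k q \<inter> {..Suc n}) = 0"
    if "c \<noteq> 0"
  proof (cases "c - 1 > n - q * k")
    case False
    \<comment> \<open>The block has no node even at time \<open>n + 1\<close>, so a jump from 0 has
      probability 0.\<close>
    hence "c = 1" "n < q * k" using step.prems that by auto
    thus ?thesis by (simp add: card_block_Int)
  qed (use step.IH in auto)
  thus ?case using step.hyps pmf_excess_pmf_Suc[OF assms(1), of n k q c] 0 by auto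
qed

lemma pmf_excess_pmf_empty_block:
  assumes "a > 0" "k \<ge> 1" "n \<ge> 1" "n \<le> q * k"
  shows "pmf (excess_pmf a k q n) c = of_bool (c = 0)"
proof -
  have "set_pmf (excess_pmf a k q n) \<subseteq> {0}"
    using pmf_excess_pmf_eq_0[OF assms(1-3), of q] assms(4) by (auto simp: set_pmf_eq)
  hence "excess_pmf a k q n = return_pmf 0" by (simp add: set_pmf_subset_singleton)
  thus ?thesis by (simp add: pmf_return)
qed

text \<open>At time \<open>k * t\<close> the first \<open>t\<close> blocks are complete, all their
  nodes have positive degree, and the degree of a merged node is its excess plus
  \<open>k\<close>.\<close>

lemma num_nodes_of_degree_identify:
  assumes "a > 0" "k \<ge> 1" "t \<ge> 1" "d \<ge> k" "G \<in> set_pmf (BO_one a (k * t))"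
  shows "num_nodes_of_degree d (identify_nodes (\<lambda>i. (i - 1) div k + 1) G)
    = (\<Sum>q<t. of_bool (excess k q G = d - k))"
proof -
  let ?f = "\<lambda>i. (i - 1) div k + 1" and ?G = "identify_nodes (\<lambda>i. (i - 1) div k + 1) G"
  have inv: "BO_inv (k * t) G" using BO_inv_BO_one assms by simp
  have deg: "node_degree ?G (Suc q) = excess k q G + k" if "q < t" for q
  proof -
    \<comment> \<open>Blocks are numbered from 0, so \<open>block k q\<close> is the fibre of the
      identification map over \<open>Suc q\<close>.\<close>
    have "v \<in> block k q \<longleftrightarrow> v \<in> {1..k * t} \<and> ?f v = Suc q" for v
    proof (cases v)
      case (Suc u)
      have "q * k + k \<le> k * t"
        using mult_le_mono2[of "Suc q" t k] that by (simp add: mult.commute add.commute)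
      moreover have "(v - 1) div k = q \<longleftrightarrow> q * k \<le> v - 1 \<and> v - 1 < Suc q * k"
        using assms(2) less_eq_div_iff_mult_less_eq[of k q "v - 1"] div_less_iff_less_mult[of k "v - 1" "Suc q"]
        by auto
      ultimately show ?thesis using Suc by (auto simp: block_def)
    qed (auto simp: block_def)
    hence "node_degree ?G (Suc q) = (\<Sum>v\<in>block k q. node_degree G v)"
      using inv by (subst node_degree_identify_nodes[of "{1..k * t}"])
        (auto simp: BO_inv_def intro!: sum.cong)
    also have "\<dots> = (\<Sum>v\<in>block k q. (node_degree G v - 1) + 1)"
    proof (intro sum.cong refl)
      fix v assume "v \<in> block k q"
      hence "v \<in> {1..k * t}" using \<open>\<And>v. v \<in> block k q \<longleftrightarrow> _ v\<close> by blast
      hence "node_degree G v \<ge> 1" using inv by (simp add: BO_inv_def)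
      thus "node_degree G v = (node_degree G v - 1) + 1" by simp
    qed
    also have "\<dots> = excess k q G + k" by (simp only: sum.distrib excess_def) (simp add: block_def)
    finally show ?thesis .
  qed
  have "nodes ?G = {1..t}"
    using assms by (intro nodes_BO_graph[of a k t]) (auto simp: BO_graph_def)
  also have "{1..t} = Suc ` {..<t}" by (simp add: image_Suc_lessThan)
  finally have "{v \<in> nodes ?G. node_degree ?G v = d} = Suc ` {q \<in> {..<t}. excess k q G = d - k}"
    using deg assms(4) by auto
  thus ?thesis
    by (simp add: num_nodes_of_degree_def card_image Collect_conj_eq lessThan_def)
qed

lemma expected_num_of_degree_eq:
  assumes "a > 0" "k \<ge> 1" "t \<ge> 1" "d \<ge> k"
  shows "expected_num_of_degree a k d t = (\<Sum>q<t. pmf (excess_pmf a k q (k * t)) (d - k))"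
proof -
  have "expected_num_of_degree a k d t = measure_pmf.expectation (BO_one a (k * t))
      (\<lambda>G. real (num_nodes_of_degree d (identify_nodes (\<lambda>i. (i - 1) div k + 1) G)))"
    by (simp add: expected_num_of_degree_def BO_graph_def)
  also have "\<dots> = measure_pmf.expectation (BO_one a (k * t))
      (\<lambda>G. \<Sum>q<t. of_bool (excess k q G = d - k))"
    using num_nodes_of_degree_identify[OF assms]
    by (intro integral_cong_AE) (auto simp: AE_measure_pmf_iff)
  also have "\<dots> = (\<Sum>q<t. pmf (excess_pmf a k q (k * t)) (d - k))"
    unfolding pmf_excess_pmf using finite_set_pmf_BO_one[OF assms(1)]
    by (intro Bochner_Integration.integral_sum integrable_measure_pmf_finite)
  finally show ?thesis .
qed

text \<open>For \<open>k dvd n\<close> this includes the block that is empty at time \<open>n\<close>.\<close>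

definition block_count :: "real \<Rightarrow> nat \<Rightarrow> nat \<Rightarrow> nat \<Rightarrow> real" where
  "block_count a k n c = (\<Sum>q\<le>n div k. pmf (excess_pmf a k q n) c)"

section \<open>Recursion for the number of blocks with given excess\<close>

lemma birth_step_sum: "birth_step r D (\<lambda>c. \<Sum>i\<in>I. f i c) c = (\<Sum>i\<in>I. birth_step r D (f i) c)"
  by (auto simp: birth_step_def sum.distrib sum_distrib_right sum_divide_distrib)

lemma birth_step_diff: "birth_step r D (\<lambda>c. f c - g c) c = birth_step r D f c - birth_step r D g c"
  by (auto simp: birth_step_def algebra_simps diff_divide_distrib)

text \<open>Replacing the number \<open>m\<close> of present nodes by \<open>k\<close> lets all
  blocks share one linear operator, so that they can be summed; the correction vanishes for
  \<open>m = k\<close>.\<close>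

lemma pmf_excess_pmf_Suc_birth_step:
  fixes a :: real and k q n :: nat
  assumes "a > 0" "n \<ge> 1"
  defines "D \<equiv> (a + 1) * real n + a" and "m \<equiv> card (block k q \<inter> {..Suc n})"
    and "P \<equiv> pmf (excess_pmf a k q n)"
  shows "pmf (excess_pmf a k q (Suc n)) c = birth_step (real k * a) D P c
    + a * (real k - real m) / D * (P c - (if c = 0 then 0 else P (c - 1)))"
proof -
  have "D > 0" using assms(1) by (simp add: D_def add_nonneg_pos)
  have *: "(real x + a * real m) / D = (real x + real k * a) / D - a * (real k - real m) / D" for x
    by (simp add: diff_divide_distrib[symmetric] algebra_simps)
  show ?thesis
    using pmf_excess_pmf_Suc[OF assms(1,2), of k q c]
    unfolding m_def[symmetric] D_def[symmetric] P_def[symmetric] birth_step_def *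
    by (auto simp: algebra_simps)
qed

text \<open>All blocks before \<open>n div k\<close> are complete, so only that one can cause an
  error. The range of summation grows exactly when \<open>k dvd Suc n\<close>, and the block added
  then is empty, with excess 0.\<close>

lemma block_count_Suc:
  fixes a :: real and k n :: nat
  assumes "a > 0" "k \<ge> 1" "n \<ge> 1"
  defines "D \<equiv> (a + 1) * real n + a"
  shows "\<bar>block_count a k (Suc n) c - of_bool (c = 0 \<and> k dvd Suc n)
    - birth_step (real k * a) D (block_count a k n) c\<bar> \<le> (if c \<le> k then real k * a / D else 0)"
proof -
  define Q where "Q = n div k"
  define m where "m = card (block k Q \<inter> {..Suc n})"
  define P where "P = pmf (excess_pmf a k Q n)"
  define s where "s = a * (real k - real m) / D * (P c - (if c = 0 then 0 else P (c - 1)))"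
  have "D > 0" using assms(1) by (simp add: D_def add_nonneg_pos)
  have "Q * k \<le> n" "n < Q * k + k"
    using assms(2) div_mult_mod_eq[of n k] mod_less_divisor[of k n] unfolding Q_def by linarith+
  have "m \<le> k" unfolding m_def card_block_Int by simp
  have full: "card (block k q \<inter> {..Suc n}) = k" if "q < Q" for q
    using mult_le_mono1[of "Suc q" Q k] that \<open>Q * k \<le> n\<close> by (simp add: card_block_Int)
  have "(\<Sum>q\<le>Q. pmf (excess_pmf a k q (Suc n)) c)
      = (\<Sum>q<Q. birth_step (real k * a) D (pmf (excess_pmf a k q n)) c)
        + pmf (excess_pmf a k Q (Suc n)) c"
    using full by (simp add: pmf_excess_pmf_Suc_birth_step[OF assms(1,3)] D_def lessThan_Suc_atMost[symmetric])
  also have "pmf (excess_pmf a k Q (Suc n)) c = birth_step (real k * a) D (pmf (excess_pmf a k Q n)) c + s"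
    unfolding s_def P_def m_def D_def by (rule pmf_excess_pmf_Suc_birth_step[OF assms(1,3)])
  moreover have "birth_step (real k * a) D (block_count a k n) c
      = (\<Sum>q\<le>Q. birth_step (real k * a) D (pmf (excess_pmf a k q n)) c)"
    by (simp only: block_count_def[abs_def] birth_step_sum Q_def)
  ultimately have main: "(\<Sum>q\<le>Q. pmf (excess_pmf a k q (Suc n)) c)
      = birth_step (real k * a) D (block_count a k n) c + s"
    by (simp add: lessThan_Suc_atMost[symmetric])
  have "block_count a k (Suc n) c
      = (\<Sum>q\<le>Q. pmf (excess_pmf a k q (Suc n)) c) + of_bool (c = 0 \<and> k dvd Suc n)"
  proof (cases "k dvd Suc n")
    case True
    have Suc: "Suc n div k = Suc Q"
      using True by (auto simp: Q_def div_Suc mod_eq_0_iff_dvd)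
    have "Suc n = Suc Q * k"
      using dvd_div_mult_self[OF True] unfolding Suc by simp
    hence "pmf (excess_pmf a k (Suc Q) (Suc n)) c = of_bool (c = 0)"
      using assms(1,2) by (intro pmf_excess_pmf_empty_block) auto
    thus ?thesis using True by (simp add: block_count_def Suc)
  qed (simp add: block_count_def Q_def div_Suc mod_eq_0_iff_dvd)
  moreover have "\<bar>s\<bar> \<le> (if c \<le> k then real k * a / D else 0)"
  proof (cases "c \<le> k")
    case True
    have "\<bar>P c - (if c = 0 then 0 else P (c - 1))\<bar> \<le> 1"
      using pmf_le_1[of "excess_pmf a k Q n" c] pmf_nonneg[of "excess_pmf a k Q n" c]
        pmf_le_1[of "excess_pmf a k Q n" "c - 1"] pmf_nonneg[of "excess_pmf a k Q n" "c - 1"]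
      by (cases "c = 0") (simp_all add: abs_le_iff P_def del: pmf_nonneg)
    hence "\<bar>s\<bar> \<le> \<bar>a * (real k - real m) / D\<bar> * 1"
      unfolding s_def abs_mult by (intro mult_left_mono) auto
    also have "\<dots> \<le> real k * a / D"
      using \<open>m \<le> k\<close> \<open>D > 0\<close> assms(1) by (simp add: abs_mult divide_right_mono)
    finally show ?thesis using True by simp
  next
    case False
    \<comment> \<open>Block \<open>Q\<close> has excess at most \<open>n - Q * k\<close> at time
      \<open>n\<close>, so for \<open>c > k\<close> there is no mass at \<open>c\<close> or
      \<open>c - 1\<close>.\<close>
    have "n - Q * k < k" using \<open>Q * k \<le> n\<close> \<open>n < Q * k + k\<close> by linarith
    hence "P c = 0" "P (c - 1) = 0"
      using False unfolding P_def by (auto intro!: pmf_excess_pmf_eq_0[OF assms(1-3)])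
    thus ?thesis using False by (simp add: s_def)
  qed
  ultimately show ?thesis using main by simp
qed


section \<open>Deviation from the limit profile\<close>

text \<open>The coefficient of the theorem in terms of the excess \<open>c = d - k\<close>.\<close>

definition limit_coeff :: "real \<Rightarrow> nat \<Rightarrow> nat \<Rightarrow> real" where
  "limit_coeff a k c = Beta (real c + real k * a) (a + 2) / Beta (real k * a) (a + 1)"

context
  fixes a :: real and k :: nat
  assumes a: "a > 0" and k: "k \<ge> 1"
begin

lemma ka_pos: "real k * a > 0"
  using a k by simp

section \<open>Recursions and decay of the limit coefficient\<close>

lemma limit_coeff_pos: "limit_coeff a k c > 0"
  unfolding limit_coeff_def using ka_pos a by (intro divide_pos_pos Beta_pos) auto

lemma limit_coeff_0: "limit_coeff a k 0 * (real k * a + (a + 1)) = a + 1"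
proof -
  have "a + 1 \<notin> \<int>\<^sub>\<le>\<^sub>0" using a by (auto dest!: nonpos_Ints_nonpos)
  from Beta_plus1_right[OF this, of "real k * a"]
  show ?thesis using Beta_pos[OF ka_pos, of "a + 1"] a
    by (simp add: limit_coeff_def field_simps)
qed

lemma limit_coeff_Suc:
  "limit_coeff a k (Suc c) * (real (Suc c) + real k * a + (a + 1)) = limit_coeff a k c * (real c + real k * a)"
proof -
  have "real c + real k * a \<notin> \<int>\<^sub>\<le>\<^sub>0"
    using ka_pos by (auto dest!: nonpos_Ints_nonpos)
  from Beta_plus1_left[OF this, of "a + 2"]
  have "(real (Suc c) + real k * a + (a + 1)) * Beta (real (Suc c) + real k * a) (a + 2)
      = (real c + real k * a) * Beta (real c + real k * a) (a + 2)"
    by (simp add: algebra_simps)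
  thus ?thesis by (simp add: limit_coeff_def mult.commute)
qed

lemma limit_coeff_le_1: "limit_coeff a k c \<le> 1"
proof (induction c)
  case 0
  have "limit_coeff a k 0 * (real k * a + (a + 1)) \<le> 1 * (real k * a + (a + 1))"
    using limit_coeff_0 ka_pos by simp
  thus ?case using ka_pos a by (simp add: mult_le_cancel_right)
next
  case (Suc c)
  have "limit_coeff a k (Suc c) * (real (Suc c) + real k * a + (a + 1))
      \<le> 1 * (real (Suc c) + real k * a + (a + 1))"
    unfolding limit_coeff_Suc using Suc ka_pos a by (intro mult_mono) auto
  thus ?case using ka_pos a by (simp add: mult_le_cancel_right)
qed

text \<open>With \<open>x = Suc c + k * a\<close>, the recursion factor
  \<open>(x - 1) / (x + a + 1)\<close> is at most \<open>(x - 1) / (x + 1)\<close>, the factor of an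
  exactly quadratic decay. One order will absorb a factor linear in \<open>n\<close>, the other
  leaves \<open>1 / c\<close>.\<close>

lemma limit_coeff_le:
  "limit_coeff a k c * ((real c + real k * a) * (real c + real k * a + 1)) \<le> real k * a * (real k * a + 1)"
proof (induction c)
  case 0
  show ?case using mult_right_mono[OF limit_coeff_le_1[of 0], of "real k * a * (real k * a + 1)"] ka_pos
    by simp
next
  case (Suc c)
  define x where "x = real (Suc c) + real k * a"
  have x: "x > 0" "real c + real k * a = x - 1" using ka_pos by (simp_all add: x_def)
  have "limit_coeff a k (Suc c) * (x * (x + 1)) \<le> limit_coeff a k (Suc c) * (x + (a + 1)) * x"
    using limit_coeff_pos[of "Suc c"] x a by (simp add: algebra_simps)
  also have "\<dots> = limit_coeff a k c * ((x - 1) * x)"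
    unfolding x_def limit_coeff_Suc by simp
  also have "\<dots> \<le> real k * a * (real k * a + 1)"
    using Suc x by simp
  finally show ?case by (simp add: x_def)
qed

text \<open>\<open>D\<close> grows by \<open>a + 1\<close> per step, so a profile proportional to
  \<open>D\<close> persists if \<open>a + 1\<close> times the coefficient is inflow minus outflow,
  which is the Beta recursion. The constant \<open>a + 1\<close> in \<open>limit_coeff_0\<close>
  becomes the source \<open>1 / k\<close>.\<close>

lemma birth_step_limit_coeff:
  fixes D :: real
  assumes "D > 0"
  shows "limit_coeff a k c * (D + (a + 1)) / ((a + 1) * real k)
    = birth_step (real k * a) D (\<lambda>c. limit_coeff a k c * D / ((a + 1) * real k)) c + of_bool (c = 0) / real k"
proof -
  have "limit_coeff a k c * (D + (a + 1)) =
      limit_coeff a k c * (D - (real c + real k * a))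
      + (if c = 0 then a + 1 else limit_coeff a k (c - 1) * (real (c - 1) + real k * a))"
    using limit_coeff_0 limit_coeff_Suc[of "c - 1"] by (cases c) (auto simp: algebra_simps)
  hence split: "limit_coeff a k c * (D + (a + 1)) / ((a + 1) * real k) =
      limit_coeff a k c * (D - (real c + real k * a)) / ((a + 1) * real k)
      + (if c = 0 then a + 1 else limit_coeff a k (c - 1) * (real (c - 1) + real k * a)) / ((a + 1) * real k)"
    by (simp only: add_divide_distrib)
  have stay: "l * D / X * (1 - x / D) = l * (D - x) / X" for l X x :: real
  proof -
    have "D * (1 - x / D) = D - x" using assms by (simp add: right_diff_distrib)
    thus ?thesis by (metis mult.assoc times_divide_eq_left)
  qed
  have move: "l * D / X * (x / D) = l * x / X" for l X x :: real
    using assms by simp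
  show ?thesis
    unfolding split birth_step_def stay move using a by simp
qed

text \<open>One step moves mass \<open>x * (k * a / D)\<close> from 0 to 1, and
  \<open>k >= 1\<close> puts both states in the range \<open>c <= k\<close>.\<close>

lemma birth_step_delta:
  fixes D :: real
  assumes "D > 0"
  shows "\<bar>birth_step (real k * a) D (\<lambda>c. x * of_bool (c = 0)) c - x * of_bool (c = 0)\<bar>
    \<le> (if c \<le> k then \<bar>x\<bar> * (real k * a / D) else 0)"
proof -
  have "birth_step (real k * a) D (\<lambda>c. x * of_bool (c = 0)) c - x * of_bool (c = 0)
      = (if c = 0 then - (x * (real k * a / D)) else if c = 1 then x * (real k * a / D) else 0)"
    by (auto simp: birth_step_def right_diff_distrib)
  moreover have "\<bar>x * (real k * a / D)\<bar> = \<bar>x\<bar> * (real k * a / D)"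
    using assms a by (simp add: abs_mult)
  moreover have "0 \<le> \<bar>x\<bar> * (real k * a / D)"
    using assms ka_pos by simp
  ultimately show ?thesis using k by auto
qed

text \<open>The limit profile gains \<open>1 / k\<close> at \<open>c = 0\<close> in every step, the count of blocks gains \<open>1\<close>
  every \<open>k\<close> steps; this is the difference.\<close>

definition block_fraction :: "nat \<Rightarrow> real" where
  "block_fraction n = 1 + real (n div k) - real n / real k"

lemma block_fraction_bounds: "0 \<le> block_fraction n" "block_fraction n \<le> 1"
proof -
  have "n div k * k \<le> n" "n \<le> n div k * k + k"
    using k div_mult_mod_eq[of n k] mod_less_divisor[of k n] by linarith+
  hence "real (n div k) * real k \<le> real n" "real n \<le> real (n div k) * real k + real k"
    by (simp_all only: of_nat_mult[symmetric] of_nat_add[symmetric] of_nat_le_iff)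
  thus "0 \<le> block_fraction n" "block_fraction n \<le> 1"
    using k by (simp_all add: block_fraction_def field_simps)
qed

lemma block_fraction_Suc:
  "block_fraction (Suc n) = block_fraction n + of_bool (k dvd Suc n) - 1 / real k"
  by (simp add: block_fraction_def div_Suc mod_eq_0_iff_dvd add_divide_distrib)

text \<open>In this form, with \<open>n + a / (a + 1)\<close> in place of \<open>n\<close>, the limit profile solves the recursion exactly.\<close>

definition deviation :: "nat \<Rightarrow> nat \<Rightarrow> real" where
  "deviation n c = block_count a k n c
     - limit_coeff a k c * ((a + 1) * real n + a) / ((a + 1) * real k)
     - block_fraction n * of_bool (c = 0)"

text \<open>The sources at \<open>c = 0\<close>, namely \<open>of_bool (k dvd Suc n)\<close> for the
  count and \<open>1 / k\<close> for the profile, differ by the increment of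
  \<open>block_fraction\<close> and cancel. The error of the last block and that of the point mass
  at 0 remain, each at most \<open>k * a / D\<close>.\<close>

lemma deviation_Suc:
  assumes "n \<ge> 1"
  defines "D \<equiv> (a + 1) * real n + a"
  shows "\<bar>deviation (Suc n) c - birth_step (real k * a) D (deviation n) c\<bar>
    \<le> (if c \<le> k then 2 * (real k * a) / D else 0)"
proof -
  let ?T = "\<lambda>f. birth_step (real k * a) D f c"
  have D: "D > 0" using a by (simp add: D_def add_nonneg_pos)
  have 1: "?T (deviation n) = ?T (block_count a k n)
      - ?T (\<lambda>c. limit_coeff a k c * D / ((a + 1) * real k))
      - ?T (\<lambda>c. block_fraction n * of_bool (c = 0))"
    unfolding deviation_def[abs_def] D_def by (simp only: birth_step_diff)
  have DS: "(a + 1) * real (Suc n) + a = D + (a + 1)" by (simp add: D_def algebra_simps)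
  have 2: "deviation (Suc n) c = block_count a k (Suc n) c
      - (?T (\<lambda>c. limit_coeff a k c * D / ((a + 1) * real k)) + of_bool (c = 0) / real k)
      - (block_fraction n + of_bool (k dvd Suc n) - 1 / real k) * of_bool (c = 0)"
    unfolding deviation_def DS birth_step_limit_coeff[OF D] block_fraction_Suc ..
  have 3: "\<bar>block_fraction n\<bar> * (real k * a / D) \<le> 1 * (real k * a / D)"
    using block_fraction_bounds[of n] ka_pos D by (intro mult_right_mono) auto
  have split: "deviation (Suc n) c - ?T (deviation n)
      = (block_count a k (Suc n) c - of_bool (c = 0 \<and> k dvd Suc n) - ?T (block_count a k n))
        + (?T (\<lambda>c. block_fraction n * of_bool (c = 0)) - block_fraction n * of_bool (c = 0))"
    unfolding 1 2 of_bool_conj by (simp add: algebra_simps)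
  have "\<bar>deviation (Suc n) c - ?T (deviation n)\<bar>
      \<le> (if c \<le> k then real k * a / D else 0) + (if c \<le> k then \<bar>block_fraction n\<bar> * (real k * a / D) else 0)"
    unfolding split using block_count_Suc[OF a k assms(1), of c, folded D_def] birth_step_delta[OF D]
    by (rule order_trans[OF abs_triangle_ineq add_mono])
  also have "\<dots> \<le> (if c \<le> k then 2 * (real k * a) / D else 0)"
  proof -
    have "real k * a / D + \<bar>block_fraction n\<bar> * (real k * a / D) \<le> real k * a / D + 1 * (real k * a / D)"
      by (intro add_left_mono 3)
    also have "\<dots> = 2 * (real k * a) / D" by simp
    finally show ?thesis by (simp only: split: if_split) simp
  qed
  finally show ?thesis .
qed

section \<open>A priori bounds on the deviation\<close>

lemma block_count_bounds: "0 \<le> block_count a k n c" "block_count a k n c \<le> real n + 1"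
proof -
  have "block_count a k n c \<le> real (card {..n div k}) * 1"
    unfolding block_count_def by (intro sum_bounded_above) (simp add: pmf_le_1)
  also have "\<dots> \<le> real n + 1" by simp
  finally show "block_count a k n c \<le> real n + 1" .
qed (simp add: block_count_def sum_nonneg)

lemma limit_term_bounds:
  "0 \<le> limit_coeff a k c * ((a + 1) * real n + a) / ((a + 1) * real k)"
  "limit_coeff a k c * ((a + 1) * real n + a) / ((a + 1) * real k) \<le> limit_coeff a k c * (real n + 1) / real k"
proof -
  have "limit_coeff a k c * ((a + 1) * real n + a) \<le> limit_coeff a k c * ((a + 1) * (real n + 1))"
    using limit_coeff_pos[of c] by (intro mult_left_mono) (auto simp: algebra_simps)
  hence "limit_coeff a k c * ((a + 1) * real n + a) / ((a + 1) * real k)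
      \<le> limit_coeff a k c * ((a + 1) * (real n + 1)) / ((a + 1) * real k)"
    using a by (intro divide_right_mono) auto
  also have "\<dots> = limit_coeff a k c * (real n + 1) / real k" using a by simp
  finally show "limit_coeff a k c * ((a + 1) * real n + a) / ((a + 1) * real k)
      \<le> limit_coeff a k c * (real n + 1) / real k" .
  show "0 \<le> limit_coeff a k c * ((a + 1) * real n + a) / ((a + 1) * real k)"
    using limit_coeff_pos[of c] a by simp
qed

lemma deviation_crude: "\<bar>deviation n c\<bar> \<le> 2 * (real n + 1)"
proof -
  have "limit_coeff a k c * (real n + 1) / real k \<le> 1 * (real n + 1) / 1"
    using limit_coeff_le_1[of c] limit_coeff_pos[of c] k by (intro frac_le mult_right_mono) auto
  moreover have "0 \<le> block_fraction n * of_bool (c = 0)" "block_fraction n * of_bool (c = 0) \<le> 1"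
    using block_fraction_bounds[of n] by auto
  moreover have "\<bar>x - y - z\<bar> \<le> 2 * (m + 1)"
    if "0 \<le> x" "x \<le> m + 1" "0 \<le> y" "y \<le> m + 1" "0 \<le> z" "z \<le> 1" "0 \<le> m" for x y z m :: real
    unfolding abs_le_iff using that by auto
  ultimately show ?thesis
    unfolding deviation_def using block_count_bounds[of n c] limit_term_bounds[of c n] by simp
qed

text \<open>Beyond \<open>n\<close> no block has mass and the point mass at 0 is absent, so only the
  limit profile is left.\<close>

lemma deviation_far:
  assumes "n \<ge> 1" "c > n"
  shows "\<bar>deviation n c\<bar> \<le> a * (real k * a + 1) / (real c + real k * a)"
proof -
  have "block_count a k n c = 0"
    unfolding block_count_def
    using assms by (intro sum.neutral ballI pmf_excess_pmf_eq_0[OF a k]) auto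
  hence "deviation n c = - (limit_coeff a k c * ((a + 1) * real n + a) / ((a + 1) * real k))"
    using assms by (simp add: deviation_def)
  hence "\<bar>deviation n c\<bar> = limit_coeff a k c * ((a + 1) * real n + a) / ((a + 1) * real k)"
    using limit_term_bounds(1)[of c n] by (simp only: abs_minus_cancel abs_of_nonneg)
  also have "\<dots> \<le> limit_coeff a k c * (real n + 1) / real k" by (rule limit_term_bounds)
  \<comment> \<open>Since \<open>n < c\<close>, the factor \<open>n + 1\<close> is traded for one
    that cancels against the quadratic decay.\<close>
  also have "\<dots> \<le> limit_coeff a k c * (real c + real k * a + 1) / real k"
    using assms limit_coeff_pos[of c] ka_pos by (intro divide_right_mono mult_left_mono) auto
  also have "\<dots> \<le> a * (real k * a + 1) / (real c + real k * a)"
    using limit_coeff_le[of c] ka_pos k by (simp add: field_simps add_pos_nonneg)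
  finally show ?thesis .
qed

lemma deviation_bound: "\<exists>K. \<forall>n\<ge>1. \<forall>c. \<bar>deviation n c\<bar> \<le> K / (real c + real k * a)"
proof (rule perturbed_birth_bound[where a = a and k = k and L = "2 * (real k * a)"])
  define B where "B = max 2 (a * (real k * a + 1))"
  show "\<bar>deviation n c\<bar> \<le> B * (real n + 1)" for n c
    by (rule order_trans[OF deviation_crude mult_right_mono]) (auto simp: B_def)
  show "\<bar>deviation n c\<bar> \<le> B / (real c + real k * a)" if "n \<ge> 1" "c > n" for n c
    using ka_pos by (intro order_trans[OF deviation_far[OF that] divide_right_mono]) (auto simp: B_def)
qed (use a ka_pos deviation_Suc in auto)

text \<open>At time \<open>k * t\<close> the count includes the empty block \<open>t\<close>, which
  \<open>block_fraction (k * t) = 1\<close> cancels. The last term comes from the shift of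
  \<open>n\<close> by \<open>a / (a + 1)\<close> in the profile.\<close>

lemma expected_num_of_degree_deviation:
  assumes "t \<ge> 1" "d \<ge> k"
  shows "expected_num_of_degree a k d t - limit_coeff a k (d - k) * real t
    = deviation (k * t) (d - k) + limit_coeff a k (d - k) * a / ((a + 1) * real k)"
proof -
  have "block_count a k (k * t) (d - k) = expected_num_of_degree a k d t + of_bool (d - k = 0)"
    using pmf_excess_pmf_empty_block[OF a k, of "k * t" t "d - k"] assms k
    by (simp add: block_count_def expected_num_of_degree_eq[OF a k] lessThan_Suc_atMost[symmetric] mult.commute)
  moreover have "block_fraction (k * t) = 1" using k by (simp add: block_fraction_def)
  moreover have "limit_coeff a k (d - k) * ((a + 1) * real (k * t) + a) / ((a + 1) * real k)
      = limit_coeff a k (d - k) * real t + limit_coeff a k (d - k) * a / ((a + 1) * real k)"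
  proof -
    let ?Z = "(a + 1) * real k"
    have "?Z \<noteq> 0" using a k by simp
    have "limit_coeff a k (d - k) * ((a + 1) * real (k * t) + a)
        = limit_coeff a k (d - k) * real t * ?Z + limit_coeff a k (d - k) * a"
      by (simp add: algebra_simps)
    thus ?thesis
      by (simp only: add_divide_distrib nonzero_mult_div_cancel_right[OF \<open>?Z \<noteq> 0\<close>])
  qed
  ultimately show ?thesis by (simp add: deviation_def)
qed

lemma expected_num_of_degree_bound:
  "\<exists>C. \<forall>d\<ge>k. \<forall>t\<ge>1. \<bar>expected_num_of_degree a k d t - limit_coeff a k (d - k) * real t\<bar> \<le> C * (1 / real d)"
proof -
  obtain K where K: "\<And>n c. n \<ge> 1 \<Longrightarrow> \<bar>deviation n c\<bar> \<le> K / (real c + real k * a)"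
    using deviation_bound by blast
  \<comment> \<open>\<open>K\<close> bounds the deviation, the second summand the term left by the
    shift.\<close>
  define K' where "K' = K + real k * a * (real k * a + 1)"
  have "0 \<le> \<bar>deviation 1 0\<bar>" by simp
  also have "\<dots> \<le> K / (real 0 + real k * a)" by (rule K) simp
  finally have "K \<ge> 0" using ka_pos by (simp add: zero_le_divide_iff)
  hence "K' \<ge> 0" using ka_pos by (simp add: K'_def)
  have "\<bar>expected_num_of_degree a k d t - limit_coeff a k (d - k) * real t\<bar> \<le> K' / min 1 a * (1 / real d)"
    if "d \<ge> k" "t \<ge> 1" for d t
  proof -
    let ?c = "d - k"
    have "limit_coeff a k ?c * a / ((a + 1) * real k) \<le> limit_coeff a k ?c * 1"
    proof -
      have "(a + 1) * 1 \<le> (a + 1) * real k" using a k by (intro mult_left_mono) auto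
      moreover have "a \<le> (a + 1) * 1" by simp
      ultimately have "a \<le> (a + 1) * real k" by (rule order_trans[rotated])
      hence "a / ((a + 1) * real k) \<le> 1" using a k by (simp only: divide_le_eq_1) auto
      thus ?thesis
        using limit_coeff_pos[of ?c] mult_left_mono[of "a / ((a + 1) * real k)" 1 "limit_coeff a k ?c"] by simp
    qed
    also have "limit_coeff a k ?c * 1 \<le> real k * a * (real k * a + 1) / (real ?c + real k * a)"
    proof -
      have "(real ?c + real k * a) * 1 \<le> (real ?c + real k * a) * (real ?c + real k * a + 1)"
        using ka_pos by (intro mult_left_mono) auto
      hence "limit_coeff a k ?c * (real ?c + real k * a)
          \<le> limit_coeff a k ?c * ((real ?c + real k * a) * (real ?c + real k * a + 1))"
        using limit_coeff_pos[of ?c] by (intro mult_left_mono) auto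
      also note limit_coeff_le
      finally show ?thesis using ka_pos by (simp add: pos_le_divide_eq add_nonneg_pos)
    qed
    finally have "limit_coeff a k ?c * a / ((a + 1) * real k)
        \<le> real k * a * (real k * a + 1) / (real ?c + real k * a)" .
    moreover have "0 \<le> limit_coeff a k ?c * a / ((a + 1) * real k)"
      using limit_coeff_pos[of ?c] a by simp
    moreover have "\<bar>deviation (k * t) ?c\<bar> \<le> K / (real ?c + real k * a)"
      using that k by (intro K) auto
    ultimately have "\<bar>expected_num_of_degree a k d t - limit_coeff a k ?c * real t\<bar>
        \<le> K' / (real ?c + real k * a)"
      unfolding expected_num_of_degree_deviation[OF that(2,1)] K'_def add_divide_distrib by linarith
    also have "\<dots> \<le> K' / (min 1 a * real d)"
    proof (rule divide_left_mono)
      \<comment> \<open>As \<open>d = c + k\<close>, a bound in \<open>c + k * a\<close> becomes one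
        in \<open>d\<close> at the cost of the factor \<open>min 1 a\<close>.\<close>
      have "min 1 a * real d = min 1 a * real ?c + min 1 a * real k"
        using that by (simp add: of_nat_diff algebra_simps)
      also have "\<dots> \<le> 1 * real ?c + a * real k" by (intro add_mono mult_right_mono) auto
      finally show "min 1 a * real d \<le> real ?c + real k * a" by (simp add: mult.commute)
    qed (use a k that ka_pos \<open>K' \<ge> 0\<close> in \<open>auto intro!: mult_pos_pos add_nonneg_pos\<close>)
    finally show ?thesis by simp
  qed
  thus ?thesis by blast
qed

text \<open>The Beta asymptotics at \<open>x = k * a\<close>, \<open>y = a + 2\<close> are evaluated
  at \<open>d - k\<close>; the shift by \<open>k\<close> does not affect the leading order.\<close>

lemma limit_coeff_asymp_equiv:
  "(\<lambda>d. limit_coeff a k (d - k)) \<sim>[at_top]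
   (\<lambda>d. Gamma (a + 2) / Beta (real k * a) (a + 1) * real d powr (- 2 - a))"
proof -
  have "(\<lambda>d. Beta (real (d - k) + real k * a) (a + 2)) \<sim>[at_top]
      (\<lambda>d. Gamma (a + 2) * real (d - k) powr (- (a + 2)))"
    using a by (intro asymp_equiv_compose'[OF Beta_asymp_equiv[OF ka_pos]] filterlim_minus_const_nat_at_top) auto
  also have "(\<lambda>d. Gamma (a + 2) * real (d - k) powr (- (a + 2))) \<sim>[at_top]
      (\<lambda>d. Gamma (a + 2) * real d powr (- (a + 2)))"
  proof (rule asymp_equiv_mult[OF asymp_equiv_refl])
    have "(\<lambda>d. (real d - real k) powr (- (a + 2))) \<sim>[at_top] (\<lambda>d. real d powr (- (a + 2)))"
      by real_asymp
    moreover have "eventually (\<lambda>d. (real d - real k) powr (- (a + 2)) = real (d - k) powr (- (a + 2))) at_top"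
      using eventually_ge_at_top[of k] by eventually_elim (simp add: of_nat_diff)
    ultimately show "(\<lambda>d. real (d - k) powr (- (a + 2))) \<sim>[at_top] (\<lambda>d. real d powr (- (a + 2)))"
      by (rule asymp_equiv_transfer) simp
  qed
  finally have "(\<lambda>d. Beta (real (d - k) + real k * a) (a + 2)) \<sim>[at_top]
      (\<lambda>d. Gamma (a + 2) * real d powr (- (a + 2)))" .
  note asymp_equiv_divide[OF this asymp_equiv_refl[of "\<lambda>_. Beta (real k * a) (a + 1)"]]
  moreover have "- (a + 2) = - 2 - a" by simp
  ultimately show ?thesis by (simp only: limit_coeff_def times_divide_eq_left)
qed

end

theorem theorem1:
  fixes a :: real and k :: nat
  assumes "a > 0" and "k \<ge> 1"
  shows "(\<exists>C::real. \<forall>d\<ge>k. \<forall>t\<ge>1.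
            \<bar>expected_num_of_degree a k d t
              - Beta (real d - real k + real k * a) (a + 2) / Beta (real k * a) (a + 1) * real t\<bar>
            \<le> C * (1 / real d))
       \<and> (\<lambda>d::nat. Beta (real d - real k + real k * a) (a + 2) / Beta (real k * a) (a + 1))
            \<sim>[at_top] (\<lambda>d. Gamma (a + 2) / Beta (real k * a) (a + 1) * real d powr (- 2 - a))
       \<and> (\<forall>d::nat. Gamma (a + 2) / Beta (real k * a) (a + 1) * real d powr (- 2 - a)
            = (a + 1) * (Gamma (real k * a + a + 1) / Gamma (real k * a)) * real d powr (- 2 - a))"
proof (intro conjI allI)
  \<comment> \<open>Real and truncated subtraction agree for \<open>d >= k\<close>, which suffices
    for the bound and, eventually, for the asymptotics.\<close>
  have coeff: "Beta (real d - real k + real k * a) (a + 2) / Beta (real k * a) (a + 1)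
      = limit_coeff a k (d - k)" if "d \<ge> k" for d
    using that by (simp add: limit_coeff_def of_nat_diff)
  show "\<exists>C::real. \<forall>d\<ge>k. \<forall>t\<ge>1.
            \<bar>expected_num_of_degree a k d t
              - Beta (real d - real k + real k * a) (a + 2) / Beta (real k * a) (a + 1) * real t\<bar>
            \<le> C * (1 / real d)"
    using expected_num_of_degree_bound[OF assms] by (simp add: coeff)
  show "(\<lambda>d::nat. Beta (real d - real k + real k * a) (a + 2) / Beta (real k * a) (a + 1))
            \<sim>[at_top] (\<lambda>d. Gamma (a + 2) / Beta (real k * a) (a + 1) * real d powr (- 2 - a))"
    by (rule asymp_equiv_transfer[OF limit_coeff_asymp_equiv[OF assms]])
      (use coeff in \<open>auto intro: eventually_mono[OF eventually_ge_at_top[of k]]\<close>)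
  fix d :: nat
  have "a + 1 \<notin> \<int>\<^sub>\<le>\<^sub>0" using assms by (auto dest!: nonpos_Ints_nonpos)
  hence "Gamma (a + 2) = (a + 1) * Gamma (a + 1)"
    using Gamma_plus1[of "a + 1"] by (simp add: add.assoc)
  moreover have "Gamma (a + 1) > 0" using assms by (simp add: Gamma_real_pos)
  ultimately show "Gamma (a + 2) / Beta (real k * a) (a + 1) * real d powr (- 2 - a)
            = (a + 1) * (Gamma (real k * a + a + 1) / Gamma (real k * a)) * real d powr (- 2 - a)"
    by (simp add: Beta_def add.assoc)
qed

end
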